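(* If pure-policy action values are continuous in $c$ and every $c\in\mathfrak C_{\rm stat}$ admits a pure SPE, then $$\min\{\mathcal J(c,\pi):c\in\mathfrak C_{\rm stat},\ \pi\in\mathrm{SPE}(c)\}$$ has a solution. Moreover, with $\mathfrak C_\pi:=\{c\in\mathfrak C_{\rm stat}:\pi\in\mathrm{SPE}(c)\}$, $$\min_{c,\pi:\,\pi\in\mathrm{SPE}(c)}\mathcal J(c,\pi)=\min_{\pi:\,\mathfrak C_\pi\ne\varnothing}\ \min_{c\in\mathfrak C_\pi}\mathcal J(c,\pi).$$ Every nonempty policy cell $\mathfrak C_\pi$ is compact.
   Context: A finite event tree with dates $0,\dots,T$, finitely many histories at each date and finite nonempty action sets $\mathcal A_t(h_t)$; $\beta\in(0,1]$. $\mathfrak C_{\rm stat}$ is a nonempty compact set (topological space) of statistically admissible compatible protocols; $\boldsymbol\Pi$ is the finite set of pure policies $\pi=(\pi_t)_{t<T}$, $\pi_t(h_t)\in\mathcal A_t(h_t)$. Each protocol $c$ and policy $\pi$ determine, for every date $t<T$, history $h_t$ and action $a$, a real current-self action value $Q_t^{\pi}(h_t,a;c)$ (the robust value of taking $a$ at $h_t$ and following $\pi$ afterwards); "pure-policy action values are continuous in $c$" means $c\mapsto Q_t^\pi(h_t,a;c)$ is continuous for each fixed $(t,h_t,a,\pi)$. $\mathrm{SPE}(c)$ is the set of pure policies $\pi\in\boldsymbol\Pi$ with $\pi_t(h_t)\in\arg\max_aQ_t^\pi(h_t,a;c)$ for every $t<T$ and $h_t$. Under a nominal law not depending on $c$,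 $d_t^\pi(h_t)\ge0$ is the probability of history $h_t$ at date $t$ under $\pi$, and $\ell_t(c;h_t,a)$ is a real fidelity loss continuous in $c$. The objective is $$\mathcal J(c,\pi)=\sum_{t<T}\beta^t\sum_{h_t}d_t^\pi(h_t)\,\ell_t(c;h_t,\pi_t(h_t)).$$ *)

theory Defs
  imports "HOL-Probability.Probability"
begin

type_synonym ('h, 'a) policy = "nat \<Rightarrow> 'h \<Rightarrow> 'a"

text \<open>
  The tree is given by the histories \<open>H t\<close> at the dates \<open>t \<le> T\<close> and a map \<open>par t\<close> sending
  a history at date \<open>Suc t\<close> to the history at date \<open>t\<close> that it extends. The nodes of the tree are
  the pairs \<open>(t, h)\<close>, so the sets \<open>H t\<close> need not be disjoint. Only decision dates \<open>t < T\<close> carry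
  actions.
\<close>

definition event_tree ::
  "nat \<Rightarrow> (nat \<Rightarrow> 'h set) \<Rightarrow> (nat \<Rightarrow> 'h \<Rightarrow> 'h) \<Rightarrow> (nat \<Rightarrow> 'h \<Rightarrow> 'a set) \<Rightarrow> bool" where
  "event_tree T H par A \<longleftrightarrow>
     (\<forall>t\<le>T. finite (H t) \<and> H t \<noteq> {}) \<and>
     (\<forall>t<T. \<forall>h\<in>H (Suc t). par t h \<in> H t) \<and>
     (\<forall>t<T. \<forall>h\<in>H t. finite (A t h) \<and> A t h \<noteq> {})"

definition paths :: "nat \<Rightarrow> (nat \<Rightarrow> 'h set) \<Rightarrow> (nat \<Rightarrow> 'h \<Rightarrow> 'h) \<Rightarrow> (nat \<Rightarrow> 'h) set" where
  "paths T H par = {\<omega>. (\<forall>t\<le>T. \<omega> t \<in> H t) \<and> (\<forall>t<T. par t (\<omega> (Suc t)) = \<omega> t)}"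

text \<open>Extensionality (the \<open>PiE\<close>) makes distinct elements distinct as policies on the tree, so
  that this set is finite.\<close>

definition pure_policies ::
  "nat \<Rightarrow> (nat \<Rightarrow> 'h set) \<Rightarrow> (nat \<Rightarrow> 'h \<Rightarrow> 'a set) \<Rightarrow> ('h, 'a) policy set" where
  "pure_policies T H A = (\<Pi>\<^sub>E t\<in>{..<T}. \<Pi>\<^sub>E h\<in>H t. A t h)"

definition SPE ::
  "nat \<Rightarrow> (nat \<Rightarrow> 'h set) \<Rightarrow> (nat \<Rightarrow> 'h \<Rightarrow> 'a set) \<Rightarrow>
   (nat \<Rightarrow> ('h, 'a) policy \<Rightarrow> 'h \<Rightarrow> 'a \<Rightarrow> 'c \<Rightarrow> real) \<Rightarrow> 'c \<Rightarrow> ('h, 'a) policy set" where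
  "SPE T H A Q c =
     {\<pi> \<in> pure_policies T H A.
        \<forall>t<T. \<forall>h\<in>H t. is_arg_max (\<lambda>a. Q t \<pi> h a c) (\<lambda>a. a \<in> A t h) (\<pi> t h)}"

definition policy_cell ::
  "nat \<Rightarrow> (nat \<Rightarrow> 'h set) \<Rightarrow> (nat \<Rightarrow> 'h \<Rightarrow> 'a set) \<Rightarrow>
   (nat \<Rightarrow> ('h, 'a) policy \<Rightarrow> 'h \<Rightarrow> 'a \<Rightarrow> 'c \<Rightarrow> real) \<Rightarrow> 'c set \<Rightarrow> ('h, 'a) policy \<Rightarrow> 'c set" where
  "policy_cell T H A Q C \<pi> = {c \<in> C. \<pi> \<in> SPE T H A Q c}"

text \<open>\<open>N \<pi>\<close> is the law of the path through the tree that the nominal model generates when \<open>\<pi>\<close>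
  is followed.\<close>

definition history_prob ::
  "(('h, 'a) policy \<Rightarrow> (nat \<Rightarrow> 'h) pmf) \<Rightarrow> nat \<Rightarrow> ('h, 'a) policy \<Rightarrow> 'h \<Rightarrow> real" where
  "history_prob N t \<pi> h = measure_pmf.prob (N \<pi>) {\<omega>. \<omega> t = h}"

definition objective ::
  "nat \<Rightarrow> (nat \<Rightarrow> 'h set) \<Rightarrow> real \<Rightarrow> (('h, 'a) policy \<Rightarrow> (nat \<Rightarrow> 'h) pmf) \<Rightarrow>
   (nat \<Rightarrow> 'c \<Rightarrow> 'h \<Rightarrow> 'a \<Rightarrow> real) \<Rightarrow> 'c \<Rightarrow> ('h, 'a) policy \<Rightarrow> real" where
  "objective T H \<beta> N l c \<pi> =
     (\<Sum>t<T. \<beta> ^ t * (\<Sum>h\<in>H t. history_prob N t \<pi> h * l t c h (\<pi> t h)))"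

text \<open>\<open>min_over f S\<close> is the minimum of \<open>f\<close> over \<open>S\<close> only when it is attained; it is
  unspecified otherwise, so attainment has to be asserted separately through \<open>attains_min\<close>.\<close>

definition attains_min :: "('x \<Rightarrow> real) \<Rightarrow> 'x set \<Rightarrow> bool" where
  "attains_min f S \<longleftrightarrow> (\<exists>x. is_arg_min f (\<lambda>x. x \<in> S) x)"

definition min_over :: "('x \<Rightarrow> real) \<Rightarrow> 'x set \<Rightarrow> real" where
  "min_over f S = (LEAST v. v \<in> f ` S)"

end

theory Submission
  imports Defs
begin

text \<open>
  Fix a policy \<open>\<pi>\<close>. That \<open>\<pi>\<close> is an SPE at \<open>c\<close> means that \<open>c\<close> satisfies the weak inequalities
  \<open>Q t \<pi> h a c \<le> Q t \<pi> h (\<pi> t h) c\<close>, in which both sides are continuous in \<open>c\<close>. Its cell is therefore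
  closed relative to the compact set \<open>C\<close>, hence compact (\<open>compact_policy_cell\<close>), and the objective,
  a finite sum of continuous functions once \<open>\<pi>\<close> is fixed, attains its minimum on the cell.

  The feasible pairs \<open>(c, \<pi>)\<close> are the disjoint union of the cells over the finitely many policies,
  and some cell is nonempty because \<open>C\<close> is and each of its points has an SPE. A minimum
  over a finite union of pieces, on each of which a minimum is attained, is the least of these minima
  (\<open>iterated_min_attained\<close> and \<open>iterated_min_eq\<close>).
\<close>

section \<open>Iterated minima\<close>

lemma min_over_eqI:
  assumes "is_arg_min f (\<lambda>x. x \<in> S) x"
  shows "min_over f S = f x"
  unfolding min_over_def
  using assms by (intro Least_equality) (auto simp: is_arg_min_linorder)

lemma attains_min_finite:
  assumes "finite S" "S \<noteq> {}"
  shows "attains_min f S"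
  using ex_is_arg_min_if_finite[OF assms] by (simp add: attains_min_def)

lemma attains_min_compact:
  assumes "compact S" "S \<noteq> {}" "continuous_on S f"
  shows "attains_min f S"
  using continuous_attains_inf[OF assms] by (auto simp: attains_min_def is_arg_min_linorder)

text \<open>Minimisers compose: an inner minimiser on a piece whose minimum is least among all pieces is a
  joint minimiser. Both the existence of a joint minimum and its value follow from this.\<close>

lemma is_arg_min_iterated:
  fixes f :: "'c \<Rightarrow> 'p \<Rightarrow> real"
  assumes inner: "\<And>p. p \<in> P \<Longrightarrow> D p \<noteq> {} \<Longrightarrow> attains_min (\<lambda>c. f c p) (D p)"
    and outer: "is_arg_min (\<lambda>p. min_over (\<lambda>c. f c p) (D p)) (\<lambda>p. p \<in> {p \<in> P. D p \<noteq> {}}) p"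
  obtains c where "is_arg_min (\<lambda>c. f c p) (\<lambda>c. c \<in> D p) c"
    and "is_arg_min (\<lambda>(c, p). f c p) (\<lambda>x. x \<in> {(c, p). p \<in> P \<and> c \<in> D p}) (c, p)"
proof -
  from outer have p: "p \<in> P" "D p \<noteq> {}"
    by (auto simp: is_arg_min_def)
  then obtain c where c: "is_arg_min (\<lambda>c. f c p) (\<lambda>c. c \<in> D p) c"
    using inner unfolding attains_min_def by blast
  have "f c p \<le> f c' p'" if piece: "p' \<in> P" "c' \<in> D p'" for c' p'
  proof -
    obtain m where m: "is_arg_min (\<lambda>c. f c p') (\<lambda>c. c \<in> D p') m"
      using inner[of p'] piece unfolding attains_min_def by blast
    have "f c p = min_over (\<lambda>c. f c p) (D p)"
      using min_over_eqI[OF c] by simp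
    also have "\<dots> \<le> min_over (\<lambda>c. f c p') (D p')"
      using outer piece by (auto simp: is_arg_min_linorder)
    also have "\<dots> = f m p'"
      by (rule min_over_eqI[OF m])
    also have "\<dots> \<le> f c' p'"
      using m piece by (simp add: is_arg_min_linorder)
    finally show ?thesis .
  qed
  with c p have "is_arg_min (\<lambda>(c, p). f c p) (\<lambda>x. x \<in> {(c, p). p \<in> P \<and> c \<in> D p}) (c, p)"
    by (auto simp: is_arg_min_linorder)
  with c show thesis by (rule that)
qed

lemma iterated_min_attained:
  fixes f :: "'c \<Rightarrow> 'p \<Rightarrow> real"
  assumes "\<And>p. p \<in> P \<Longrightarrow> D p \<noteq> {} \<Longrightarrow> attains_min (\<lambda>c. f c p) (D p)"
    and "attains_min (\<lambda>p. min_over (\<lambda>c. f c p) (D p)) {p \<in> P. D p \<noteq> {}}"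
  shows "attains_min (\<lambda>(c, p). f c p) {(c, p). p \<in> P \<and> c \<in> D p}"
proof -
  obtain p where "is_arg_min (\<lambda>p. min_over (\<lambda>c. f c p) (D p)) (\<lambda>p. p \<in> {p \<in> P. D p \<noteq> {}}) p"
    using assms(2) unfolding attains_min_def by blast
  from is_arg_min_iterated[OF assms(1) this] show ?thesis
    unfolding attains_min_def by metis
qed

lemma iterated_min_eq:
  fixes f :: "'c \<Rightarrow> 'p \<Rightarrow> real"
  assumes "\<And>p. p \<in> P \<Longrightarrow> D p \<noteq> {} \<Longrightarrow> attains_min (\<lambda>c. f c p) (D p)"
    and "attains_min (\<lambda>p. min_over (\<lambda>c. f c p) (D p)) {p \<in> P. D p \<noteq> {}}"
  shows "min_over (\<lambda>(c, p). f c p) {(c, p). p \<in> P \<and> c \<in> D p}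
    = min_over (\<lambda>p. min_over (\<lambda>c. f c p) (D p)) {p \<in> P. D p \<noteq> {}}"
proof -
  obtain p where p:
    "is_arg_min (\<lambda>p. min_over (\<lambda>c. f c p) (D p)) (\<lambda>p. p \<in> {p \<in> P. D p \<noteq> {}}) p"
    using assms(2) unfolding attains_min_def by blast
  from is_arg_min_iterated[OF assms(1) this] obtain c
    where c: "is_arg_min (\<lambda>c. f c p) (\<lambda>c. c \<in> D p) c"
      and cp: "is_arg_min (\<lambda>(c, p). f c p) (\<lambda>x. x \<in> {(c, p). p \<in> P \<and> c \<in> D p}) (c, p)" .
  show ?thesis
    unfolding min_over_eqI[OF cp] min_over_eqI[OF p] min_over_eqI[OF c] by simp
qed

section \<open>Policies and their cells\<close>

lemma finite_pure_policies:
  assumes "event_tree T H par A"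
  shows "finite (pure_policies T H A)"
  using assms unfolding pure_policies_def event_tree_def
  by (intro finite_PiE) auto

lemma pure_policy_action:
  assumes "\<pi> \<in> pure_policies T H A" "t < T" "h \<in> H t"
  shows "\<pi> t h \<in> A t h"
  using assms unfolding pure_policies_def by (blast dest: PiE_mem)

lemma Sigma_SPE_eq_cells:
  "(SIGMA c:C. SPE T H A Q c)
    = {(c, \<pi>). \<pi> \<in> pure_policies T H A \<and> c \<in> policy_cell T H A Q C \<pi>}"
  by (auto simp: policy_cell_def SPE_def)

text \<open>Inserting \<open>C\<close> keeps the family nonempty when there is no decision date (\<open>T = 0\<close>), where every
  protocol supports the unique policy and the cell is \<open>C\<close> itself.\<close>

lemma policy_cell_eq_Inter:
  assumes "\<pi> \<in> pure_policies T H A"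
  shows "policy_cell T H A Q C \<pi>
    = \<Inter> (insert C ((\<lambda>(t, h, a). {c \<in> C. Q t \<pi> h a c \<le> Q t \<pi> h (\<pi> t h) c})
        ` (SIGMA t:{..<T}. SIGMA h:H t. A t h)))"
  using assms pure_policy_action[OF assms]
  by (auto simp: policy_cell_def SPE_def is_arg_max_linorder)

lemma closedin_le:
  fixes f g :: "'c::topological_space \<Rightarrow> real"
  assumes "continuous_on C f" "continuous_on C g"
  shows "closedin (top_of_set C) {c \<in> C. f c \<le> g c}"
proof -
  have "continuous_on C (\<lambda>c. g c - f c)"
    using assms by (intro continuous_intros)
  then have "closedin (top_of_set C) (C \<inter> (\<lambda>c. g c - f c) -` {0..})"
    by (rule continuous_closedin_preimage) simp
  also have "C \<inter> (\<lambda>c. g c - f c) -` {0..} = {c \<in> C. f c \<le> g c}"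
    by auto
  finally show ?thesis .
qed

text \<open>The optimality conditions are weak inequalities between continuous functions, so they survive
  limits inside \<open>C\<close>; a relatively closed subset of a compact set is compact in any
  topological space.\<close>

lemma compact_policy_cell:
  fixes C :: "'c::topological_space set"
  assumes C: "compact C" and \<pi>: "\<pi> \<in> pure_policies T H A"
    and Q: "\<And>t h a. t < T \<Longrightarrow> h \<in> H t \<Longrightarrow> a \<in> A t h \<Longrightarrow> continuous_on C (\<lambda>c. Q t \<pi> h a c)"
  shows "compact (policy_cell T H A Q C \<pi>)"
proof -
  have "closedin (top_of_set C) (policy_cell T H A Q C \<pi>)"
    unfolding policy_cell_eq_Inter[OF \<pi>]
  proof (rule closedin_Inter)
    fix S
    assume "S \<in> insert C ((\<lambda>(t, h, a). {c \<in> C. Q t \<pi> h a c \<le> Q t \<pi> h (\<pi> t h) c})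
        ` (SIGMA t:{..<T}. SIGMA h:H t. A t h))"
    then show "closedin (top_of_set C) S"
      by (auto intro!: closedin_le Q pure_policy_action[OF \<pi>])
  qed simp
  with C show ?thesis
    unfolding closedin_closed by (auto intro: compact_Int_closed)
qed

lemma continuous_on_objective:
  fixes C :: "'c::topological_space set"
  assumes "\<pi> \<in> pure_policies T H A"
    and "\<And>t h a. t < T \<Longrightarrow> h \<in> H t \<Longrightarrow> a \<in> A t h \<Longrightarrow> continuous_on C (\<lambda>c. l t c h a)"
  shows "continuous_on C (\<lambda>c. objective T H \<beta> N l c \<pi>)"
  unfolding objective_def
  using assms by (auto intro!: continuous_on_sum continuous_on_mult_left pure_policy_action)

section \<open>Existence and decomposition of the optimum\<close>

theorem proposition8p2:
  fixes T :: nat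
    and H :: "nat \<Rightarrow> 'h set"
    and par :: "nat \<Rightarrow> 'h \<Rightarrow> 'h"
    and A :: "nat \<Rightarrow> 'h \<Rightarrow> 'a set"
    and \<beta> :: real
    and C :: "'c::topological_space set"
    and Q :: "nat \<Rightarrow> ('h, 'a) policy \<Rightarrow> 'h \<Rightarrow> 'a \<Rightarrow> 'c \<Rightarrow> real"
    and N :: "('h, 'a) policy \<Rightarrow> (nat \<Rightarrow> 'h) pmf"
    and l :: "nat \<Rightarrow> 'c \<Rightarrow> 'h \<Rightarrow> 'a \<Rightarrow> real"
  assumes tree: "event_tree T H par A"
    and discount: "0 < \<beta>" "\<beta> \<le> 1"
    and C_compact: "compact C" and C_nonempty: "C \<noteq> {}"
    and nominal: "\<And>\<pi>. \<pi> \<in> pure_policies T H A \<Longrightarrow> set_pmf (N \<pi>) \<subseteq> paths T H par"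
    and loss_continuous: "\<And>t h a. t < T \<Longrightarrow> h \<in> H t \<Longrightarrow> a \<in> A t h \<Longrightarrow>
           continuous_on C (\<lambda>c. l t c h a)"
    and Q_continuous: "\<And>t h a \<pi>. t < T \<Longrightarrow> h \<in> H t \<Longrightarrow> a \<in> A t h \<Longrightarrow>
           \<pi> \<in> pure_policies T H A \<Longrightarrow> continuous_on C (\<lambda>c. Q t \<pi> h a c)"
    and SPE_exists: "\<And>c. c \<in> C \<Longrightarrow> SPE T H A Q c \<noteq> {}"
  defines "J \<equiv> objective T H \<beta> N l"
    and "cell \<equiv> policy_cell T H A Q C"
  shows "attains_min (\<lambda>(c, \<pi>). J c \<pi>) (SIGMA c:C. SPE T H A Q c)
    \<and> (\<forall>\<pi> \<in> pure_policies T H A. cell \<pi> \<noteq> {} \<longrightarrow> attains_min (\<lambda>c. J c \<pi>) (cell \<pi>))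
    \<and> attains_min (\<lambda>\<pi>. min_over (\<lambda>c. J c \<pi>) (cell \<pi>)) {\<pi> \<in> pure_policies T H A. cell \<pi> \<noteq> {}}
    \<and> min_over (\<lambda>(c, \<pi>). J c \<pi>) (SIGMA c:C. SPE T H A Q c)
       = min_over (\<lambda>\<pi>. min_over (\<lambda>c. J c \<pi>) (cell \<pi>)) {\<pi> \<in> pure_policies T H A. cell \<pi> \<noteq> {}}
    \<and> (\<forall>\<pi> \<in> pure_policies T H A. cell \<pi> \<noteq> {} \<longrightarrow> compact (cell \<pi>))"
proof -
  let ?P = "pure_policies T H A"
  have cell_compact: "compact (cell \<pi>)" if "\<pi> \<in> ?P" for \<pi>
    unfolding cell_def using C_compact that Q_continuous by (intro compact_policy_cell) auto
  have inner: "attains_min (\<lambda>c. J c \<pi>) (cell \<pi>)" if "\<pi> \<in> ?P" "cell \<pi> \<noteq> {}" for \<pi>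
  proof (rule attains_min_compact)
    have "continuous_on C (\<lambda>c. J c \<pi>)"
      unfolding J_def using that(1) loss_continuous by (rule continuous_on_objective)
    then show "continuous_on (cell \<pi>) (\<lambda>c. J c \<pi>)"
      by (rule continuous_on_subset) (auto simp: cell_def policy_cell_def)
  qed (use that cell_compact in auto)
  have "{\<pi> \<in> ?P. cell \<pi> \<noteq> {}} \<noteq> {}"
  proof -
    obtain c \<pi> where "c \<in> C" "\<pi> \<in> SPE T H A Q c"
      using C_nonempty SPE_exists by blast
    then have "\<pi> \<in> ?P" "c \<in> cell \<pi>"
      by (auto simp: cell_def policy_cell_def SPE_def)
    then show ?thesis by blast
  qed
  then have outer: "attains_min (\<lambda>\<pi>. min_over (\<lambda>c. J c \<pi>) (cell \<pi>)) {\<pi> \<in> ?P. cell \<pi> \<noteq> {}}"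
    using finite_pure_policies[OF tree] by (intro attains_min_finite) auto
  have pairs: "(SIGMA c:C. SPE T H A Q c) = {(c, \<pi>). \<pi> \<in> ?P \<and> c \<in> cell \<pi>}"
    unfolding cell_def by (rule Sigma_SPE_eq_cells)
  show ?thesis
    unfolding pairs
    using iterated_min_attained[of ?P cell J] iterated_min_eq[of ?P cell J]
      inner outer cell_compact
    by blast
qed

end
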